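(* Let $n,N\ge 1$ be integers, let $A_1,\ldots,A_n\in\mathbb{S}^N_{++}$, and let $\lambda_1,\ldots,\lambda_n>0$ with $\sum_{i=1}^n\lambda_i=1$. Write $\boldsymbol{A}=(A_1,\ldots,A_n)$ and $\boldsymbol{\lambda}=(\lambda_1,\ldots,\lambda_n)$. Then: (i) For every $\mu>0$, $$\mathcal{H}(\boldsymbol{A},\boldsymbol{\lambda})\preceq \mathcal{R}_{\mu}(\boldsymbol{A},\boldsymbol{\lambda})\preceq \mathcal{A}(\boldsymbol{A},\boldsymbol{\lambda});$$ in particular, $\mathcal{R}_{\mu}(\boldsymbol{A},\boldsymbol{\lambda})\in\mathbb{S}^N_{++}$. (ii) $\mathcal{R}_{\mu}(\boldsymbol{A},\boldsymbol{\lambda})\to\mathcal{A}(\boldsymbol{A},\boldsymbol{\lambda})$ as $\mu\to 0^+$. (iii) $\mathcal{R}_{\mu}(\boldsymbol{A},\boldsymbol{\lambda})\to\mathcal{H}(\boldsymbol{A},\boldsymbol{\lambda})$ as $\mu\to+\infty$.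
   Context: $\mathbb{S}^N$ is the space of real symmetric $N\times N$ matrices, $\mathbb{S}^N_{++}\subset\mathbb{S}^N$ is the set of positive definite matrices, and $\mathbb{S}^N_{+}$ the set of positive semidefinite ones. For $X,Y\in\mathbb{S}^N$, $Y\preceq X$ means $X-Y\in\mathbb{S}^N_+$. $\mathrm{Id}$ is the $N\times N$ identity matrix. For $\mu>0$, the resolvent average is $$\mathcal{R}_{\mu}(\boldsymbol{A},\boldsymbol{\lambda})=\big[\lambda_1(A_1+\mu^{-1}\mathrm{Id})^{-1}+\cdots+\lambda_n(A_n+\mu^{-1}\mathrm{Id})^{-1}\big]^{-1}-\mu^{-1}\mathrm{Id}.$$ The harmonic and arithmetic averages are $$\mathcal{H}(\boldsymbol{A},\boldsymbol{\lambda})=(\lambda_1A_1^{-1}+\cdots+\lambda_nA_n^{-1})^{-1},\qquad \mathcal{A}(\boldsymbol{A},\boldsymbol{\lambda})=\lambda_1A_1+\cdots+\lambda_nA_n.$$ Convergence of matrices is with respect to any norm on the finite-dimensional space $\mathbb{S}^N$ (all are equivalent). *)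

theory Defs
  imports "HOL-Analysis.Analysis"
begin

definition sym_matrices :: "(real^'N^'N) set" where
  "sym_matrices = {X. transpose X = X}"

definition psd_matrices :: "(real^'N^'N) set" where
  "psd_matrices = {X \<in> sym_matrices. \<forall>x. 0 \<le> x \<bullet> (X *v x)}"

definition pd_matrices :: "(real^'N^'N) set" where
  "pd_matrices = {X \<in> sym_matrices. \<forall>x. x \<noteq> 0 \<longrightarrow> 0 < x \<bullet> (X *v x)}"

text \<open>The Loewner order is a relation on symmetric matrices only, so both arguments are
  required to be symmetric. The componentwise order on \<^typ>\<open>real^'N^'N\<close>
  from the library is a different relation.\<close>

definition loewner_le :: "real^'N^'N \<Rightarrow> real^'N^'N \<Rightarrow> bool"  (infix "\<preceq>" 50) where
  "Y \<preceq> X \<longleftrightarrow> X \<in> sym_matrices \<and> Y \<in> sym_matrices \<and> X - Y \<in> psd_matrices"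

text \<open>Families of \<open>n\<close> matrices and weights are functions on \<^typ>\<open>nat\<close>, of which only the
  values at the indices \<open>1, \<dots>, n\<close> matter.\<close>

definition arithmetic_average ::
    "nat \<Rightarrow> (nat \<Rightarrow> real^'N^'N) \<Rightarrow> (nat \<Rightarrow> real) \<Rightarrow> real^'N^'N" where
  "arithmetic_average n A w = (\<Sum>i=1..n. w i *\<^sub>R A i)"

definition harmonic_average ::
    "nat \<Rightarrow> (nat \<Rightarrow> real^'N^'N) \<Rightarrow> (nat \<Rightarrow> real) \<Rightarrow> real^'N^'N" where
  "harmonic_average n A w = matrix_inv (\<Sum>i=1..n. w i *\<^sub>R matrix_inv (A i))"

definition resolvent_average ::
    "real \<Rightarrow> nat \<Rightarrow> (nat \<Rightarrow> real^'N^'N) \<Rightarrow> (nat \<Rightarrow> real) \<Rightarrow> real^'N^'N" where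
  "resolvent_average \<mu> n A w =
     matrix_inv (\<Sum>i=1..n. w i *\<^sub>R matrix_inv (A i + inverse \<mu> *\<^sub>R mat 1)) - inverse \<mu> *\<^sub>R mat 1"

end

theory Submission
  imports Defs
begin

text \<open>The harmonic average has the variational description
  \<open>x \<bullet> H x = min {\<Sum>i. w\<^sub>i (y\<^sub>i \<bullet> A\<^sub>i y\<^sub>i) | \<Sum>i. w\<^sub>i y\<^sub>i = x}\<close>, attained at
  \<open>y\<^sub>i = A\<^sub>i\<^sup>-\<^sup>1 H x\<close>. Since the resolvent average is the harmonic average of the shifted
  matrices \<open>A\<^sub>i + c Id\<close>, \<open>c = \<mu>\<^sup>-\<^sup>1\<close>, minus \<open>c Id\<close>, inserting the minimizers and other test
  vectors bounds its quadratic form: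
  \<open>x \<bullet> H x \<le> x \<bullet> R x \<le> x \<bullet> H x + c (\<Sum>i. w\<^sub>i |y\<^sub>i|\<^sup>2 - |x|\<^sup>2)\<close> and
  \<open>x \<bullet> A x - \<mu> (\<Sum>i. w\<^sub>i |A\<^sub>i x|\<^sup>2) \<le> x \<bullet> R x \<le> x \<bullet> A x\<close>.
  The limits follow by squeezing and polarization.\<close>

section \<open>Quadratic forms and symmetric matrices\<close>

lemma matrix_inner_sum:
  fixes B :: "'i \<Rightarrow> real^'N^'N" and u :: "'i \<Rightarrow> real"
  shows "x \<bullet> ((\<Sum>i\<in>I. u i *\<^sub>R B i) *v y) = (\<Sum>i\<in>I. u i * (x \<bullet> (B i *v y)))"
  by (induction I rule: infinite_finite_induct)
     (simp_all add: matrix_vector_mult_add_rdistrib inner_add_right scaleR_matrix_vector_assoc [symmetric])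

lemma matrix_vector_mult_sum:
  fixes B :: "'i \<Rightarrow> real^'N^'N" and u :: "'i \<Rightarrow> real"
  shows "(\<Sum>i\<in>I. u i *\<^sub>R B i) *v y = (\<Sum>i\<in>I. u i *\<^sub>R (B i *v y))"
  by (induction I rule: infinite_finite_induct)
     (simp_all add: matrix_vector_mult_add_rdistrib scaleR_matrix_vector_assoc [symmetric])

lemma inner_shifted_matrix:
  fixes X :: "real^'N^'N"
  shows "x \<bullet> ((X + c *\<^sub>R mat 1) *v y) = x \<bullet> (X *v y) + c * (x \<bullet> y)"
  by (simp add: matrix_vector_mult_add_rdistrib inner_add_right scaleR_matrix_vector_assoc [symmetric])

lemma sym_matrices_inner_commute:
  "X \<in> sym_matrices \<Longrightarrow> x \<bullet> (X *v y) = y \<bullet> (X *v x)"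
  by (metis (mono_tags, lifting) dot_lmul_matrix inner_commute mem_Collect_eq sym_matrices_def
      transpose_matrix_vector)

lemma sym_matrices_add:
  "X \<in> sym_matrices \<Longrightarrow> Y \<in> sym_matrices \<Longrightarrow> X + Y \<in> sym_matrices"
  by (simp add: sym_matrices_def transpose_def vec_eq_iff)

lemma sym_matrices_diff:
  "X \<in> sym_matrices \<Longrightarrow> Y \<in> sym_matrices \<Longrightarrow> X - Y \<in> sym_matrices"
  by (simp add: sym_matrices_def transpose_def vec_eq_iff)

lemma sym_matrices_scaleR:
  "X \<in> sym_matrices \<Longrightarrow> c *\<^sub>R X \<in> sym_matrices"
  by (simp add: sym_matrices_def transpose_def vec_eq_iff)

lemma sym_matrices_id: "mat 1 \<in> sym_matrices"
  by (simp add: sym_matrices_def transpose_mat)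

lemma sym_matrices_sum:
  "(\<And>i. i \<in> I \<Longrightarrow> B i \<in> sym_matrices) \<Longrightarrow> (\<Sum>i\<in>I. u i *\<^sub>R B i) \<in> sym_matrices"
  by (simp add: sym_matrices_def transpose_def vec_eq_iff)

text \<open>Polarization at two basis vectors recovers the entry at \<open>i\<close>,
  \<open>j\<close> from three values of the quadratic form, so limits of matrices reduce to limits
  of scalars. Symmetry is what makes the form determine the entry; without it only the symmetric
  part would be recovered.\<close>

lemma sym_matrices_tendsto_polarization:
  fixes F :: "'a \<Rightarrow> real^'N^'N"
  assumes "\<forall>\<^sub>F t in net. F t \<in> sym_matrices" "L \<in> sym_matrices"
    and lim: "\<And>x. ((\<lambda>t. x \<bullet> (F t *v x)) \<longlongrightarrow> x \<bullet> (L *v x)) net"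
  shows "(F \<longlongrightarrow> L) net"
proof (intro vec_tendstoI)
  fix i j
  let ?q = "\<lambda>(X :: real^'N^'N) x. x \<bullet> (X *v x)"
  let ?p = "\<lambda>X. (?q X (axis i 1 + axis j 1) - ?q X (axis i 1) - ?q X (axis j 1)) / 2"
  have entry: "?p X = X $ i $ j" if "X \<in> sym_matrices" for X :: "real^'N^'N"
    using sym_matrices_inner_commute[OF that, of "axis j 1" "axis i 1"]
    by (simp add: matrix_vector_right_distrib inner_add_left inner_add_right
        inner_axis' matrix_vector_mult_basis column_def)
  have "((\<lambda>t. ?p (F t)) \<longlongrightarrow> ?p L) net"
    by (intro tendsto_intros lim) simp
  moreover have "\<forall>\<^sub>F t in net. ?p (F t) = F t $ i $ j"
    using assms(1) by eventually_elim (rule entry)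
  ultimately show "((\<lambda>t. F t $ i $ j) \<longlongrightarrow> L $ i $ j) net"
    unfolding entry[OF assms(2)] by (rule Lim_transform_eventually)
qed

section \<open>Positive definite matrices and their inverses\<close>

lemma pd_matrices_sym: "X \<in> pd_matrices \<Longrightarrow> X \<in> sym_matrices"
  by (simp add: pd_matrices_def)

lemma pd_matrices_inner_nonneg: "X \<in> pd_matrices \<Longrightarrow> 0 \<le> x \<bullet> (X *v x)"
  by (cases "x = 0") (auto simp: pd_matrices_def intro: less_imp_le)

lemma pd_matrices_invertible:
  fixes X :: "real^'N^'N"
  assumes "X \<in> pd_matrices"
  shows "invertible X"
  unfolding invertible_left_inverse matrix_left_invertible_ker
  using assms by (force simp: pd_matrices_def)

text \<open>\<open>matrix_inv\<close> is chosen by \<open>SOME\<close>, so invertibility is exactly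
  the existence that makes the choice a two-sided inverse.\<close>

lemma invertible_matrix_inv:
  assumes "invertible X"
  shows "X ** matrix_inv X = mat 1" and "matrix_inv X ** X = mat 1"
  using someI_ex[OF assms[unfolded invertible_def]] by (simp_all add: matrix_inv_def)

lemma pd_matrices_mult_matrix_inv:
  fixes X :: "real^'N^'N"
  assumes "X \<in> pd_matrices"
  shows "X *v (matrix_inv X *v x) = x"
  using invertible_matrix_inv(1)[OF pd_matrices_invertible[OF assms]]
  by (simp add: matrix_vector_mul_assoc)

lemma pd_matrices_matrix_inv:
  fixes X :: "real^'N^'N"
  assumes "X \<in> pd_matrices"
  shows "matrix_inv X \<in> pd_matrices"
proof -
  note inv = invertible_matrix_inv[OF pd_matrices_invertible[OF assms]]
  \<comment> \<open>Transposing X X^-1 = Id turns the transposed inverse into a left inverse of X,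
    and a left inverse agrees with the right inverse X^-1.\<close>
  have "transpose (matrix_inv X) ** X = mat 1"
    using assms inv(1) matrix_transpose_mul[of X "matrix_inv X"]
    by (simp add: pd_matrices_def sym_matrices_def transpose_mat)
  then have "transpose (matrix_inv X) = matrix_inv X"
    by (metis inv(1) matrix_mul_assoc matrix_mul_lid matrix_mul_rid)
  moreover have "0 < x \<bullet> (matrix_inv X *v x)" if "x \<noteq> 0" for x
  proof -
    \<comment> \<open>The substitution x = X y turns the form of the inverse at x into the form of X
      at y.\<close>
    let ?y = "matrix_inv X *v x"
    have "x = X *v ?y"
      using assms by (simp add: pd_matrices_mult_matrix_inv)
    then have "?y \<noteq> 0"
      using that by auto
    then have "0 < ?y \<bullet> (X *v ?y)"
      using assms by (simp add: pd_matrices_def)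
    then show ?thesis
      using assms by (simp add: pd_matrices_mult_matrix_inv inner_commute)
  qed
  ultimately show ?thesis
    by (simp add: pd_matrices_def sym_matrices_def)
qed

lemma pd_matrices_sum:
  assumes "finite I" "I \<noteq> {}" "\<And>i. i \<in> I \<Longrightarrow> B i \<in> pd_matrices" "\<And>i. i \<in> I \<Longrightarrow> 0 < u i"
  shows "(\<Sum>i\<in>I. u i *\<^sub>R B i) \<in> pd_matrices"
  using assms unfolding pd_matrices_def
  by (auto simp: matrix_inner_sum intro!: sym_matrices_sum sum_pos)

lemma pd_matrices_shift:
  assumes "X \<in> pd_matrices" "0 \<le> c"
  shows "X + c *\<^sub>R mat 1 \<in> pd_matrices"
  using assms unfolding pd_matrices_def
  by (auto simp: inner_shifted_matrix
      intro!: sym_matrices_add sym_matrices_scaleR sym_matrices_id add_pos_nonneg)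

lemma loewner_leI:
  assumes "X \<in> sym_matrices" "Y \<in> sym_matrices" "\<And>x. x \<bullet> (Y *v x) \<le> x \<bullet> (X *v x)"
  shows "Y \<preceq> X"
  using assms
  by (simp add: loewner_le_def psd_matrices_def sym_matrices_diff
      matrix_vector_mult_diff_rdistrib inner_diff_right)

section \<open>The variational description of the harmonic average\<close>

lemma harmonic_average_pd:
  assumes "n \<ge> 1" "\<And>i. i \<in> {1..n} \<Longrightarrow> A i \<in> pd_matrices" "\<And>i. i \<in> {1..n} \<Longrightarrow> 0 < w i"
  shows "harmonic_average n A w \<in> pd_matrices"
  unfolding harmonic_average_def using assms
  by (intro pd_matrices_matrix_inv pd_matrices_sum) auto

text \<open>The vectors \<open>y x i\<close> satisfy the Lagrange condition of the constrained
  minimization: \<open>A i *v y x i\<close> is the same vector H x for every i. The constraint holds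
  because H inverts the weighted sum of inverses, and the common value H x factors out of the
  weighted sum of the forms.\<close>

lemma harmonic_average_minimizer:
  fixes A :: "nat \<Rightarrow> real^'N^'N"
  assumes "n \<ge> 1" "\<And>i. i \<in> {1..n} \<Longrightarrow> A i \<in> pd_matrices" "\<And>i. i \<in> {1..n} \<Longrightarrow> 0 < w i"
  defines "y \<equiv> \<lambda>x i. matrix_inv (A i) *v (harmonic_average n A w *v x)"
  shows "(\<Sum>i=1..n. w i *\<^sub>R y x i) = x"
    and "(\<Sum>i=1..n. w i * (y x i \<bullet> (A i *v y x i))) = x \<bullet> (harmonic_average n A w *v x)"
proof -
  let ?S = "\<Sum>i=1..n. w i *\<^sub>R matrix_inv (A i)"
  have "?S \<in> pd_matrices"
    using assms(1-3) by (intro pd_matrices_matrix_inv pd_matrices_sum) auto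
  then show sum_y: "(\<Sum>i=1..n. w i *\<^sub>R y x i) = x"
    unfolding y_def matrix_vector_mult_sum [symmetric] harmonic_average_def
    by (rule pd_matrices_mult_matrix_inv)
  have "(\<Sum>i=1..n. w i * (y x i \<bullet> (A i *v y x i)))
      = (\<Sum>i=1..n. w i *\<^sub>R y x i) \<bullet> (harmonic_average n A w *v x)"
    unfolding inner_sum_left y_def
    by (intro sum.cong) (simp_all add: pd_matrices_mult_matrix_inv assms(2))
  then show "(\<Sum>i=1..n. w i * (y x i \<bullet> (A i *v y x i))) = x \<bullet> (harmonic_average n A w *v x)"
    unfolding sum_y .
qed

text \<open>Take the weighted sum of the nonnegative forms of \<open>A i\<close> at
  \<open>y i - v i\<close>, where \<open>v i\<close> is the minimizer. Since
  \<open>A i *v v i\<close> is the same vector z = H x for every i, the cross terms see the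
  \<open>y i\<close> only through their weighted sum x and give -2 (x \<bullet> z), while the terms
  in \<open>v i\<close> give x \<bullet> z.\<close>

lemma harmonic_average_le:
  fixes A :: "nat \<Rightarrow> real^'N^'N"
  assumes n: "n \<ge> 1" and A: "\<And>i. i \<in> {1..n} \<Longrightarrow> A i \<in> pd_matrices"
    and w: "\<And>i. i \<in> {1..n} \<Longrightarrow> 0 < w i"
    and x: "(\<Sum>i=1..n. w i *\<^sub>R y i) = x"
  shows "x \<bullet> (harmonic_average n A w *v x) \<le> (\<Sum>i=1..n. w i * (y i \<bullet> (A i *v y i)))"
proof -
  let ?z = "harmonic_average n A w *v x"
  define v where "v i = matrix_inv (A i) *v ?z" for i
  have Av: "A i *v v i = ?z" if "i \<in> {1..n}" for i
    using that by (simp add: v_def pd_matrices_mult_matrix_inv A)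
  have "0 \<le> w i * (y i \<bullet> (A i *v y i)) - 2 * (w i * (y i \<bullet> ?z)) + w i * (v i \<bullet> (A i *v v i))"
    if i: "i \<in> {1..n}" for i
  proof -
    have "0 \<le> w i * ((y i - v i) \<bullet> (A i *v (y i - v i)))"
      using i w[OF i] pd_matrices_inner_nonneg[OF A[OF i]] by simp
    also have "(y i - v i) \<bullet> (A i *v (y i - v i))
        = y i \<bullet> (A i *v y i) - 2 * (y i \<bullet> ?z) + v i \<bullet> (A i *v v i)"
      using sym_matrices_inner_commute[OF pd_matrices_sym[OF A[OF i]], of "v i" "y i"] Av[OF i]
      by (simp add: matrix_vector_mult_diff_distrib inner_diff_left inner_diff_right)
    finally show ?thesis
      by (simp add: algebra_simps)
  qed
  then have "0 \<le> (\<Sum>i=1..n. w i * (y i \<bullet> (A i *v y i)) - 2 * (w i * (y i \<bullet> ?z))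
      + w i * (v i \<bullet> (A i *v v i)))"
    by (rule sum_nonneg)
  also have "\<dots> = (\<Sum>i=1..n. w i * (y i \<bullet> (A i *v y i))) - 2 * ((\<Sum>i=1..n. w i *\<^sub>R y i) \<bullet> ?z)
      + (\<Sum>i=1..n. w i * (v i \<bullet> (A i *v v i)))"
    by (simp add: sum.distrib sum_subtractf sum_distrib_left inner_sum_left)
  also have "(\<Sum>i=1..n. w i * (v i \<bullet> (A i *v v i))) = x \<bullet> ?z"
    unfolding v_def by (rule harmonic_average_minimizer(2)[OF n A w])
  finally show ?thesis
    using x by simp
qed

section \<open>The resolvent average as a shifted harmonic average\<close>

lemma resolvent_average_eq_harmonic_average:
  "resolvent_average \<mu> n A w
    = harmonic_average n (\<lambda>i. A i + inverse \<mu> *\<^sub>R mat 1) w - inverse \<mu> *\<^sub>R mat 1"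
  by (simp add: resolvent_average_def harmonic_average_def)

context
  fixes n :: nat and A :: "nat \<Rightarrow> real^'N^'N" and w :: "nat \<Rightarrow> real" and \<mu> :: real
  assumes n: "n \<ge> 1" and A: "\<And>i. i \<in> {1..n} \<Longrightarrow> A i \<in> pd_matrices"
    and w: "\<And>i. i \<in> {1..n} \<Longrightarrow> 0 < w i" and \<mu>: "0 < \<mu>"
begin

lemma shifted_pd:
  "i \<in> {1..n} \<Longrightarrow> A i + inverse \<mu> *\<^sub>R mat 1 \<in> pd_matrices"
  using A \<mu> by (simp add: pd_matrices_shift)

lemma resolvent_average_sym: "resolvent_average \<mu> n A w \<in> sym_matrices"
  unfolding resolvent_average_eq_harmonic_average
  by (intro sym_matrices_diff sym_matrices_scaleR sym_matrices_id pd_matrices_sym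
      harmonic_average_pd n shifted_pd w)

text \<open>The shift adds c = \<open>inverse \<mu>\<close> times the weighted square norms to the
  harmonic bound, and subtracting c Id removes c (x \<bullet> x). Each choice of admissible
  \<open>y\<close> yields an upper bound.\<close>

lemma resolvent_average_le:
  assumes "(\<Sum>i=1..n. w i *\<^sub>R y i) = x"
  shows "x \<bullet> (resolvent_average \<mu> n A w *v x)
    \<le> (\<Sum>i=1..n. w i * (y i \<bullet> (A i *v y i))) + inverse \<mu> * ((\<Sum>i=1..n. w i * (y i \<bullet> y i)) - x \<bullet> x)"
  using harmonic_average_le[OF n shifted_pd w assms]
  by (simp add: resolvent_average_eq_harmonic_average inner_shifted_matrix
      matrix_vector_mult_diff_rdistrib inner_diff_right scaleR_matrix_vector_assoc [symmetric]
      sum.distrib sum_distrib_left algebra_simps)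

text \<open>Equality at the minimizers of the shifted problem; a lower bound for the resolvent
  average can thus be proved by estimating the right-hand side for one admissible, otherwise unknown
  \<open>y\<close>.\<close>

lemma resolvent_average_attained:
  obtains y where "(\<Sum>i=1..n. w i *\<^sub>R y i) = x"
    and "x \<bullet> (resolvent_average \<mu> n A w *v x)
      = (\<Sum>i=1..n. w i * (y i \<bullet> (A i *v y i))) + inverse \<mu> * ((\<Sum>i=1..n. w i * (y i \<bullet> y i)) - x \<bullet> x)"
proof (rule that)
  let ?B = "\<lambda>i. A i + inverse \<mu> *\<^sub>R mat 1"
  let ?y = "\<lambda>i. matrix_inv (?B i) *v (harmonic_average n ?B w *v x)"
  show "(\<Sum>i=1..n. w i *\<^sub>R ?y i) = x"
    by (rule harmonic_average_minimizer(1)[OF n shifted_pd w])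
  show "x \<bullet> (resolvent_average \<mu> n A w *v x)
      = (\<Sum>i=1..n. w i * (?y i \<bullet> (A i *v ?y i))) + inverse \<mu> * ((\<Sum>i=1..n. w i * (?y i \<bullet> ?y i)) - x \<bullet> x)"
    using harmonic_average_minimizer(2)[OF n shifted_pd w, where x = x]
    unfolding inner_shifted_matrix
    by (simp add: resolvent_average_eq_harmonic_average
      matrix_vector_mult_diff_rdistrib inner_diff_right scaleR_matrix_vector_assoc [symmetric]
      sum.distrib sum_distrib_left algebra_simps)
qed

section \<open>Bounds on the quadratic form for weights of total 1\<close>

context
  assumes w_sum: "(\<Sum>i=1..n. w i) = 1"
begin

text \<open>Variance identity for the mean x of the \<open>y i\<close>; it shows that the factor of
  \<open>inverse \<mu>\<close> in the two preceding results is nonnegative.\<close>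

lemma weighted_variance:
  fixes y :: "nat \<Rightarrow> real^'N"
  assumes "(\<Sum>i=1..n. w i *\<^sub>R y i) = x"
  shows "(\<Sum>i=1..n. w i * (y i \<bullet> y i)) - x \<bullet> x = (\<Sum>i=1..n. w i * ((y i - x) \<bullet> (y i - x)))"
proof -
  have "(\<Sum>i=1..n. w i * ((y i - x) \<bullet> (y i - x)))
      = (\<Sum>i=1..n. w i * (y i \<bullet> y i)) - 2 * ((\<Sum>i=1..n. w i *\<^sub>R y i) \<bullet> x) + (\<Sum>i=1..n. w i) * (x \<bullet> x)"
    unfolding inner_sum_left sum_distrib_left sum_distrib_right
    by (simp add: sum.distrib [symmetric] sum_subtractf [symmetric])
       (intro sum.cong, simp_all add: inner_diff_left inner_diff_right inner_commute algebra_simps)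
  then show ?thesis
    using assms w_sum by simp
qed

text \<open>The minimizers of the shifted problem are also admissible for the harmonic average, and
  the variance penalty only increases the value.\<close>

lemma harmonic_le_resolvent_average:
  "x \<bullet> (harmonic_average n A w *v x) \<le> x \<bullet> (resolvent_average \<mu> n A w *v x)"
proof -
  obtain y where y: "(\<Sum>i=1..n. w i *\<^sub>R y i) = x"
    and eq: "x \<bullet> (resolvent_average \<mu> n A w *v x)
      = (\<Sum>i=1..n. w i * (y i \<bullet> (A i *v y i))) + inverse \<mu> * ((\<Sum>i=1..n. w i * (y i \<bullet> y i)) - x \<bullet> x)"
    by (rule resolvent_average_attained)
  have "0 \<le> inverse \<mu> * ((\<Sum>i=1..n. w i * (y i \<bullet> y i)) - x \<bullet> x)"
    unfolding weighted_variance[OF y] using \<mu> w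
    by (intro mult_nonneg_nonneg sum_nonneg) (auto intro: less_imp_le)
  with harmonic_average_le[where A = A, OF n A w y] show ?thesis
    unfolding eq by linarith
qed

text \<open>The constant family \<open>y i\<close> = x has variance zero.\<close>

lemma resolvent_le_arithmetic_average:
  "x \<bullet> (resolvent_average \<mu> n A w *v x) \<le> x \<bullet> (arithmetic_average n A w *v x)"
  using resolvent_average_le[of "\<lambda>_. x" x] w_sum
  by (simp add: arithmetic_average_def matrix_inner_sum
      flip: scaleR_left.sum sum_distrib_right)

text \<open>At the minimizers write \<open>y i\<close> = x + d. The possibly negative term 2 (d
  \<bullet> \<open>A i *v x\<close>) is absorbed by the variance penalty
  \<open>inverse \<mu>\<close> (d \<bullet> d), at a cost of order \<mu> that does not involve
  d.\<close>

lemma arithmetic_diff_le_resolvent_average: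
  "x \<bullet> (arithmetic_average n A w *v x) - \<mu> * (\<Sum>i=1..n. w i * ((A i *v x) \<bullet> (A i *v x)))
    \<le> x \<bullet> (resolvent_average \<mu> n A w *v x)"
proof -
  obtain y where y: "(\<Sum>i=1..n. w i *\<^sub>R y i) = x"
    and eq: "x \<bullet> (resolvent_average \<mu> n A w *v x)
      = (\<Sum>i=1..n. w i * (y i \<bullet> (A i *v y i))) + inverse \<mu> * ((\<Sum>i=1..n. w i * (y i \<bullet> y i)) - x \<bullet> x)"
    by (rule resolvent_average_attained)
  have "w i * (x \<bullet> (A i *v x)) - \<mu> * (w i * ((A i *v x) \<bullet> (A i *v x)))
      \<le> w i * (y i \<bullet> (A i *v y i)) + inverse \<mu> * (w i * ((y i - x) \<bullet> (y i - x)))"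
    if i: "i \<in> {1..n}" for i
  proof -
    define d where "d = y i - x"
    have "y i \<bullet> (A i *v y i) = x \<bullet> (A i *v x) + 2 * (d \<bullet> (A i *v x)) + d \<bullet> (A i *v d)"
      using sym_matrices_inner_commute[OF pd_matrices_sym[OF A[OF i]], of x d]
      by (simp add: d_def matrix_vector_mult_diff_distrib inner_diff_left inner_diff_right)
    moreover have "0 \<le> d \<bullet> (A i *v d)"
      using A[OF i] by (rule pd_matrices_inner_nonneg)
    \<comment> \<open>Completing the square: the factor \<mu> in front of \<open>A i *v x\<close>
      makes the cross term exactly 2 (d \<bullet> \<open>A i *v x\<close>).\<close>
    moreover have "0 \<le> inverse \<mu> * ((d + \<mu> *\<^sub>R (A i *v x)) \<bullet> (d + \<mu> *\<^sub>R (A i *v x)))"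
      using \<mu> by simp
    then have "0 \<le> inverse \<mu> * (d \<bullet> d) + 2 * (d \<bullet> (A i *v x)) + \<mu> * ((A i *v x) \<bullet> (A i *v x))"
      using \<mu> by (simp add: inner_add_left inner_add_right inner_commute field_simps)
    ultimately have "x \<bullet> (A i *v x) - \<mu> * ((A i *v x) \<bullet> (A i *v x))
        \<le> y i \<bullet> (A i *v y i) + inverse \<mu> * (d \<bullet> d)"
      by linarith
    from mult_left_mono[OF this less_imp_le[OF w[OF i]]] show ?thesis
      by (simp add: d_def algebra_simps)
  qed
  then have "(\<Sum>i=1..n. w i * (x \<bullet> (A i *v x)) - \<mu> * (w i * ((A i *v x) \<bullet> (A i *v x))))
      \<le> (\<Sum>i=1..n. w i * (y i \<bullet> (A i *v y i)) + inverse \<mu> * (w i * ((y i - x) \<bullet> (y i - x))))"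
    by (rule sum_mono)
  then show ?thesis
    unfolding eq weighted_variance[OF y]
    by (simp add: arithmetic_average_def matrix_inner_sum sum.distrib sum_subtractf sum_distrib_left)
qed

end

end

section \<open>The Loewner bounds and the two limits\<close>

theorem theorem4p2:
  fixes n :: nat and A :: "nat \<Rightarrow> real^'N^'N" and w :: "nat \<Rightarrow> real"
  assumes "n \<ge> 1"
    and "\<And>i. i \<in> {1..n} \<Longrightarrow> A i \<in> pd_matrices"
    and "\<And>i. i \<in> {1..n} \<Longrightarrow> w i > 0"
    and "(\<Sum>i=1..n. w i) = 1"
  shows "(\<forall>\<mu>>0. harmonic_average n A w \<preceq> resolvent_average \<mu> n A w
              \<and> resolvent_average \<mu> n A w \<preceq> arithmetic_average n A w
              \<and> resolvent_average \<mu> n A w \<in> pd_matrices)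
       \<and> ((\<lambda>\<mu>. resolvent_average \<mu> n A w) \<longlongrightarrow> arithmetic_average n A w) (at_right 0)
       \<and> ((\<lambda>\<mu>. resolvent_average \<mu> n A w) \<longlongrightarrow> harmonic_average n A w) at_top"
proof (intro conjI allI impI)
  let ?H = "harmonic_average n A w" and ?M = "arithmetic_average n A w"
  let ?R = "\<lambda>\<mu>. resolvent_average \<mu> n A w"
  have H: "?H \<in> pd_matrices"
    using assms(1-3) by (rule harmonic_average_pd)
  have M: "?M \<in> sym_matrices"
    unfolding arithmetic_average_def by (intro sym_matrices_sum pd_matrices_sym assms(2))
  have R: "?R \<mu> \<in> sym_matrices" if "\<mu> > 0" for \<mu>
    using assms(1-3) that by (rule resolvent_average_sym)
  have HR: "x \<bullet> (?H *v x) \<le> x \<bullet> (?R \<mu> *v x)" if "\<mu> > 0" for \<mu> x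
    using assms(1-3) that assms(4) by (rule harmonic_le_resolvent_average)
  have RM: "x \<bullet> (?R \<mu> *v x) \<le> x \<bullet> (?M *v x)" if "\<mu> > 0" for \<mu> x
    using assms(1-3) that assms(4) by (rule resolvent_le_arithmetic_average)
  {
    fix \<mu> :: real assume \<mu>: "\<mu> > 0"
    show "?H \<preceq> ?R \<mu>"
      by (intro loewner_leI R[OF \<mu>] HR[OF \<mu>] pd_matrices_sym[OF H])
    show "?R \<mu> \<preceq> ?M"
      by (intro loewner_leI R[OF \<mu>] RM[OF \<mu>] M)
    \<comment> \<open>Strict positivity is inherited from \<open>?H\<close> through the lower
      bound.\<close>
    show "?R \<mu> \<in> pd_matrices"
      using H R[OF \<mu>] HR[OF \<mu>] by (force simp: pd_matrices_def intro: less_le_trans)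
  }
  show "(?R \<longlongrightarrow> ?M) (at_right 0)"
  proof (rule sym_matrices_tendsto_polarization)
    show "\<forall>\<^sub>F \<mu> in at_right 0. ?R \<mu> \<in> sym_matrices"
      using eventually_at_right_less by eventually_elim (rule R)
    fix x
    \<comment> \<open>\<open>?K\<close> does not depend on \<mu>, so the gap \<mu> \<open>?K\<close>
      between the two bounds vanishes at 0.\<close>
    let ?K = "\<Sum>i=1..n. w i * ((A i *v x) \<bullet> (A i *v x))"
    show "((\<lambda>\<mu>. x \<bullet> (?R \<mu> *v x)) \<longlongrightarrow> x \<bullet> (?M *v x)) (at_right 0)"
    proof (rule tendsto_sandwich)
      show "\<forall>\<^sub>F \<mu> in at_right 0. x \<bullet> (?M *v x) - \<mu> * ?K \<le> x \<bullet> (?R \<mu> *v x)"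
        using eventually_at_right_less
        by eventually_elim (rule arithmetic_diff_le_resolvent_average[OF assms(1-3) _ assms(4)])
      show "\<forall>\<^sub>F \<mu> in at_right 0. x \<bullet> (?R \<mu> *v x) \<le> x \<bullet> (?M *v x)"
        using eventually_at_right_less by eventually_elim (rule RM)
      show "((\<lambda>\<mu>. x \<bullet> (?M *v x) - \<mu> * ?K) \<longlongrightarrow> x \<bullet> (?M *v x)) (at_right 0)"
        by (auto intro!: tendsto_eq_intros)
    qed simp
  qed (rule M)
  show "(?R \<longlongrightarrow> ?H) at_top"
  proof (rule sym_matrices_tendsto_polarization)
    show "\<forall>\<^sub>F \<mu> in at_top. ?R \<mu> \<in> sym_matrices"
      using eventually_gt_at_top[of 0] by eventually_elim (rule R)
    fix x
    \<comment> \<open>The minimizers for the unshifted matrices serve as test vectors. They do not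
      depend on \<mu>, so their variance \<open>?K\<close> is constant and
      \<open>inverse \<mu> * ?K\<close> tends to 0.\<close>
    let ?y = "\<lambda>i. matrix_inv (A i) *v (?H *v x)"
    let ?K = "(\<Sum>i=1..n. w i * (?y i \<bullet> ?y i)) - x \<bullet> x"
    have y: "(\<Sum>i=1..n. w i *\<^sub>R ?y i) = x"
      by (rule harmonic_average_minimizer(1)[OF assms(1-3)])
    have Hx: "(\<Sum>i=1..n. w i * (?y i \<bullet> (A i *v ?y i))) = x \<bullet> (?H *v x)"
      by (rule harmonic_average_minimizer(2)[OF assms(1-3)])
    show "((\<lambda>\<mu>. x \<bullet> (?R \<mu> *v x)) \<longlongrightarrow> x \<bullet> (?H *v x)) at_top"
    proof (rule tendsto_sandwich)
      show "\<forall>\<^sub>F \<mu> in at_top. x \<bullet> (?H *v x) \<le> x \<bullet> (?R \<mu> *v x)"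
        using eventually_gt_at_top[of 0] by eventually_elim (rule HR)
      show "\<forall>\<^sub>F \<mu> in at_top. x \<bullet> (?R \<mu> *v x) \<le> x \<bullet> (?H *v x) + inverse \<mu> * ?K"
        using eventually_gt_at_top[of 0]
        by eventually_elim (rule resolvent_average_le[where A = A, OF assms(1-3) _ y, unfolded Hx])
      show "((\<lambda>\<mu>. x \<bullet> (?H *v x) + inverse \<mu> * ?K) \<longlongrightarrow> x \<bullet> (?H *v x)) at_top"
        using tendsto_add[OF tendsto_const tendsto_mult_left_zero[OF tendsto_inverse_0_at_top[OF filterlim_ident]]]
        by simp
    qed simp
  qed (rule pd_matrices_sym[OF H])
qed

end
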